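(* Let $B$ be a commutative ring. (a) For an arbitrary pair of polynomials $p,q\in B[y]$ there exists an automorphism $\gamma=\gamma_{p,q}\in{\rm Aut}_B\,B[y,v]$ such that $$\gamma\bigl((y-q(p(y)),v)\bigr)=(y-p(q(y)),v).$$ (b) In particular, for any $a\in B$ and $p\in B[y]$ there exists $\gamma\in{\rm Aut}_B\,B[y,v]$ such that $$\gamma\bigl((y+ap(y),v)\bigr)=(y+p(ay),v).$$ Moreover, if $a^k\mid p(0)$ then there exists an automorphism $\gamma_k\in{\rm Aut}_B\,B[y,v]$ such that $$\gamma_k\bigl((y+ap(y),v)\bigr)=\Bigl(y+\frac{p(a^{k+1}y)}{a^k},v\Bigr).$$
   Context: $(f,g)$ denotes the ideal of $B[y,v]$ generated by $f$ and $g$. ${\rm Aut}_B\,B[y,v]$ is the group of $B$-algebra automorphisms. If $p=\sum_ip_iy^i$ and $p(0)=a^kc$, then $p(a^{k+1}y)/a^k$ denotes $c+\sum_{i\ge1}p_ia^{(k+1)i-k}y^i$. *)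

theory Defs
  imports "HOL-Algebra.UnivPoly" "HOL-Algebra.QuotRing"
begin

text \<open>
  \<open>B\<close> is a commutative ring record \<open>R\<close> with \<open>cring R\<close> (the zero ring is allowed),
  \<open>B[y]\<close> is \<open>UP R\<close>, and \<open>B[y,v]\<close> is the iterated polynomial ring \<open>B[y][v]\<close>.
\<close>

abbreviation poly_yv :: "('a, 'm) ring_scheme \<Rightarrow> (nat \<Rightarrow> 'a, nat \<Rightarrow> nat \<Rightarrow> 'a) up_ring"
  where "poly_yv R \<equiv> UP (UP R)"

definition var_y :: "('a, 'm) ring_scheme \<Rightarrow> nat \<Rightarrow> 'a"
  where "var_y R = monom (UP R) \<one>\<^bsub>R\<^esub> 1"

definition var_v :: "('a, 'm) ring_scheme \<Rightarrow> nat \<Rightarrow> nat \<Rightarrow> 'a"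
  where "var_v R = monom (poly_yv R) \<one>\<^bsub>UP R\<^esub> 1"

definition const_y :: "('a, 'm) ring_scheme \<Rightarrow> 'a \<Rightarrow> nat \<Rightarrow> 'a"
  where "const_y R b = monom (UP R) b 0"

definition embed_y :: "('a, 'm) ring_scheme \<Rightarrow> (nat \<Rightarrow> 'a) \<Rightarrow> nat \<Rightarrow> nat \<Rightarrow> 'a"
  where "embed_y R f = monom (poly_yv R) f 0"

text \<open>The \<open>B\<close>-algebra structure map of \<open>B[y,v]\<close> is \<open>embed_y R \<circ> const_y R\<close>.\<close>

definition alg_aut_yv ::
    "('a, 'm) ring_scheme \<Rightarrow> ((nat \<Rightarrow> nat \<Rightarrow> 'a) \<Rightarrow> (nat \<Rightarrow> nat \<Rightarrow> 'a)) set"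
  where "alg_aut_yv R =
    {\<gamma> \<in> ring_iso (poly_yv R) (poly_yv R).
       \<forall>b \<in> carrier R. \<gamma> (embed_y R (const_y R b)) = embed_y R (const_y R b)}"

definition ideal_v :: "('a, 'm) ring_scheme \<Rightarrow> (nat \<Rightarrow> 'a) \<Rightarrow> (nat \<Rightarrow> nat \<Rightarrow> 'a) set"
  where "ideal_v R f = Idl\<^bsub>poly_yv R\<^esub> {embed_y R f, var_v R}"

text \<open>\<open>subst_y R p q\<close> is \<open>p(q(y))\<close>.\<close>

definition subst_y :: "('a, 'm) ring_scheme \<Rightarrow> (nat \<Rightarrow> 'a) \<Rightarrow> (nat \<Rightarrow> 'a) \<Rightarrow> nat \<Rightarrow> 'a"
  where "subst_y R p q = eval R (UP R) (const_y R) q p"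

text \<open>
  \<open>scaled_quot R a k c p\<close> is \<open>p(a^(k+1) y)/a^k\<close>, namely \<open>c\<close> plus the sum of
  \<open>p_i a^((k+1)i-k) y^i\<close> over \<open>i \<ge> 1\<close>, where \<open>p(0) = a^k c\<close>.  Since \<open>a\<close> may be a
  zero divisor, \<open>c\<close> is not determined by \<open>a\<close>, \<open>k\<close> and \<open>p\<close>, so it is an argument.
  The natural number subtraction in the exponent never truncates, as \<open>i \<ge> 1\<close>.
\<close>

definition scaled_quot ::
    "('a, 'm) ring_scheme \<Rightarrow> 'a \<Rightarrow> nat \<Rightarrow> 'a \<Rightarrow> (nat \<Rightarrow> 'a) \<Rightarrow> nat \<Rightarrow> 'a"
  where "scaled_quot R a k c p =
    const_y R c \<oplus>\<^bsub>UP R\<^esub>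
    (\<Oplus>\<^bsub>UP R\<^esub> i \<in> {1..deg R p}.
       monom (UP R) (coeff (UP R) p i \<otimes>\<^bsub>R\<^esub> a [^]\<^bsub>R\<^esub> ((k + 1) * i - k)) i)"

end

theory Submission
  imports Defs
begin

text \<open>
  The ideal \<open>(y - q(p(y)), v)\<close> is a disguised form of an ideal that is symmetric in the
  pairs \<open>(y, q)\<close> and \<open>(v, p)\<close>.  The shear \<open>v \<mapsto> v - p(y)\<close>, which fixes \<open>y\<close>, carries it to
  \<open>(y - q(p(y)), v - p(y))\<close>.  Modulo the second generator \<open>p(y)\<close> is \<open>v\<close>, so this is
  \<open>(y - q(v), v - p(y))\<close> (lemma \<open>ideal_v_equiv_graph_ideal\<close>).  Exchanging \<open>y\<close> and \<open>v\<close> turns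
  the latter into \<open>(y - p(v), v - q(y))\<close>, the same ideal with \<open>p\<close> and \<open>q\<close> exchanged, and the
  inverse of the shear by \<open>q(y)\<close> leads from there to \<open>(y - p(q(y)), v)\<close>.  The automorphism of
  part (a) is therefore a shear, a swap and an inverse shear (\<open>ideal_v_subst_equiv\<close>).

  The first claim of part (b) is the case of the polynomials \<open>-p\<close> and \<open>a y\<close>.  It moves a
  factor \<open>a\<close> from outside \<open>p\<close> to its argument.  If \<open>a\<close> divides \<open>p(0)\<close>, then \<open>p(a y) = a p'(y)\<close>
  for some \<open>p'\<close>, and the step can be applied again to \<open>y + a p'(y)\<close>; if \<open>a^k\<close> divides \<open>p(0)\<close>,
  it can be applied \<open>k + 1\<close> times in all, which yields the second claim
  (\<open>ideal_v_scaled_quot_equiv\<close>).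

  Automorphisms are obtained from the universal property of polynomial rings: \<open>B\<close>-algebra
  endomorphisms of \<open>B[y,v]\<close> can be prescribed on \<open>y\<close> and \<open>v\<close> and are determined by these two
  values, so an endomorphism is bijective once another one undoes it on \<open>y\<close> and \<open>v\<close>.
\<close>

section \<open>Homomorphisms out of polynomial rings\<close>

lemma
  assumes "cring R" "cring S" "h \<in> ring_hom R S" "s \<in> carrier S"
  shows eval_in_ring_hom: "eval R S h s \<in> ring_hom (UP R) S"
    and eval_at_const: "r \<in> carrier R \<Longrightarrow> eval R S h s (monom (UP R) r 0) = h r"
    and eval_at_var: "eval R S h s (monom (UP R) \<one>\<^bsub>R\<^esub> 1) = s"
proof -
  interpret UP_pre_univ_prop R S h "UP R"
    using UP_pre_univ_propI[OF assms(1-3)] by simp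
  show "eval R S h s \<in> ring_hom (UP R) S" "eval R S h s (monom (UP R) \<one>\<^bsub>R\<^esub> 1) = s"
    using eval_ring_hom eval_monom1 assms(4) by auto
  show "r \<in> carrier R \<Longrightarrow> eval R S h s (monom (UP R) r 0) = h r"
    using eval_const assms(4) by auto
qed

text \<open>
  The uniqueness half of the universal property, in a form that compares two homomorphisms
  without naming the map that both of them induce on coefficients.
\<close>

lemma UP_hom_eqI:
  assumes "cring R" "cring S"
    and \<phi>: "\<phi> \<in> ring_hom (UP R) S" and \<psi>: "\<psi> \<in> ring_hom (UP R) S"
    and var: "\<phi> (monom (UP R) \<one>\<^bsub>R\<^esub> 1) = \<psi> (monom (UP R) \<one>\<^bsub>R\<^esub> 1)"
    and const: "\<And>r. r \<in> carrier R \<Longrightarrow> \<phi> (monom (UP R) r 0) = \<psi> (monom (UP R) r 0)"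
    and p: "p \<in> carrier (UP R)"
  shows "\<phi> p = \<psi> p"
proof -
  interpret U: UP_cring R "UP R"
    using assms(1) by (simp add: UP_cring.intro)
  define h where "h = \<psi> \<circ> (\<lambda>r. monom (UP R) r 0)"
  have h: "h \<in> ring_hom R S"
    unfolding h_def by (rule ring_hom_trans[OF U.const_ring_hom \<psi>])
  interpret UP_pre_univ_prop R S h "UP R"
    using UP_pre_univ_propI[OF assms(1,2) h] by simp
  show ?thesis
  proof (rule UP_hom_unique)
    show "ring_hom_cring (UP R) S \<phi>" "ring_hom_cring (UP R) S \<psi>"
      using ring_homD \<phi> \<psi> by auto
    show "\<phi> (monom (UP R) \<one>\<^bsub>R\<^esub> (Suc 0)) = \<psi> (monom (UP R) \<one>\<^bsub>R\<^esub> (Suc 0))"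
      using var by simp
    show "\<psi> (monom (UP R) \<one>\<^bsub>R\<^esub> (Suc 0)) \<in> carrier S"
      by (rule ring_hom_closed[OF \<psi>]) simp
  qed (use const p in \<open>auto simp: h_def\<close>)
qed

lemma ring_hom_minus:
  assumes "ring R" "ring S" "\<phi> \<in> ring_hom R S" "x \<in> carrier R" "y \<in> carrier R"
  shows "\<phi> (x \<ominus>\<^bsub>R\<^esub> y) = \<phi> x \<ominus>\<^bsub>S\<^esub> \<phi> y"
proof -
  interpret ring_hom_ring R S \<phi>
    using assms by (simp add: ring_hom_ringI2)
  show ?thesis
    using assms by (simp add: a_minus_def)
qed

section \<open>Ideals\<close>

lemma (in ring) genideal_diff_subset:
  assumes carr: "f \<in> carrier R" "f' \<in> carrier R" "g \<in> carrier R"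
    and diff: "f \<ominus> f' \<in> Idl {f, g}"
  shows "Idl {f', g} \<subseteq> Idl {f, g}"
proof -
  interpret I: ideal "Idl {f, g}" R
    using carr by (simp add: genideal_ideal)
  have mem: "f \<in> Idl {f, g}" "g \<in> Idl {f, g}"
    using genideal_self[of "{f, g}"] carr by auto
  have "f' = f \<ominus> (f \<ominus> f')"
    using carr by algebra
  then have "f' \<in> Idl {f, g}"
    using mem diff by (metis I.a_closed I.a_inv_closed a_minus_def)
  then show ?thesis
    using mem by (intro genideal_minimal I.is_ideal) auto
qed

text \<open>
  A generator may be changed by an element of the ideal that the other one generates.
  Quantifying over all ideals that contain \<open>g\<close> lets the same congruence serve for both inclusions.
\<close>

lemma (in ring) genideal_replace_congruent:
  assumes carr: "f \<in> carrier R" "f' \<in> carrier R" "g \<in> carrier R"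
    and diff: "\<And>I. ideal I R \<Longrightarrow> g \<in> I \<Longrightarrow> f \<ominus> f' \<in> I"
  shows "Idl {f, g} = Idl {f', g}"
proof -
  have ideals: "ideal (Idl {h, g}) R" "g \<in> Idl {h, g}" if "h \<in> carrier R" for h
    using that carr genideal_self[of "{h, g}"] by (auto intro: genideal_ideal)
  have "f' \<ominus> f = \<ominus> (f \<ominus> f')"
    using carr by algebra
  moreover have "f \<ominus> f' \<in> Idl {f', g}" "f \<ominus> f' \<in> Idl {f, g}"
    using diff ideals carr by auto
  ultimately show ?thesis
    using genideal_diff_subset[of f f' g] genideal_diff_subset[of f' f g] carr
      additive_subgroup.a_inv_closed[OF ideal.axioms(1)[OF ideals(1)[of f']]] by auto
qed

text \<open>
  One inclusion holds for every homomorphism, because the preimage of an ideal is an ideal.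
  Applied to the inverse isomorphism it gives the other inclusion.
\<close>

lemma ring_iso_image_genideal:
  assumes "ring R" "ring S" and \<phi>: "\<phi> \<in> ring_iso R S" and A: "A \<subseteq> carrier R"
  shows "\<phi> ` (Idl\<^bsub>R\<^esub> A) = Idl\<^bsub>S\<^esub> (\<phi> ` A)"
proof -
  \<comment> \<open>Stated for arbitrary rings, since it is used in both directions, with the types of the two
    rings interchanged.\<close>
  have preimage: "Idl\<^bsub>R\<^esub> A \<subseteq> {x \<in> carrier R. \<phi> x \<in> Idl\<^bsub>S\<^esub> (\<phi> ` A)}"
    if "ring R" "ring S" "\<phi> \<in> ring_hom R S" "A \<subseteq> carrier R"
    for R :: "('p, 'q) ring_scheme" and S :: "('r, 's) ring_scheme" and \<phi> A
  proof -
    interpret ring_hom_ring R S \<phi>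
      using that by (simp add: ring_hom_ringI2)
    have img: "\<phi> ` A \<subseteq> carrier S"
      using that(4) by auto
    show ?thesis
      using that(4) S.genideal_self[OF img]
      by (intro R.genideal_minimal ideal_vimage S.genideal_ideal img) auto
  qed
  define \<psi> where "\<psi> = inv_into (carrier R) \<phi>"
  have \<psi>: "\<psi> \<in> ring_iso S R"
    unfolding \<psi>_def by (rule ring_iso_set_sym[OF assms(1) \<phi>])
  have hom: "\<phi> \<in> ring_hom R S" "\<psi> \<in> ring_hom S R"
    and bij: "bij_betw \<phi> (carrier R) (carrier S)"
    using \<phi> \<psi> by (auto simp: ring_iso_def)
  have inv: "\<psi> (\<phi> x) = x" if "x \<in> carrier R" for x
    unfolding \<psi>_def using bij that by (meson bij_betw_inv_into_left)
  have inv': "\<phi> (\<psi> x) = x" if "x \<in> carrier S" for x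
    unfolding \<psi>_def using bij that by (meson bij_betw_inv_into_right)
  have img: "\<phi> ` A \<subseteq> carrier S" "\<psi> ` \<phi> ` A = A"
    using A hom(1) inv by (auto simp: ring_hom_closed image_image subset_iff)
  show ?thesis
  proof
    show "\<phi> ` (Idl\<^bsub>R\<^esub> A) \<subseteq> Idl\<^bsub>S\<^esub> (\<phi> ` A)"
      using preimage[OF assms(1,2) hom(1) A] by auto
    show "Idl\<^bsub>S\<^esub> (\<phi> ` A) \<subseteq> \<phi> ` (Idl\<^bsub>R\<^esub> A)"
    proof
      fix x assume "x \<in> Idl\<^bsub>S\<^esub> (\<phi> ` A)"
      then have "x \<in> carrier S" "\<psi> x \<in> Idl\<^bsub>R\<^esub> A"
        using preimage[OF assms(2,1) hom(2) img(1)] img(2) by auto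
      then show "x \<in> \<phi> ` (Idl\<^bsub>R\<^esub> A)"
        using inv' by (metis imageI)
    qed
  qed
qed

section \<open>Algebra endomorphisms of the bivariate polynomial ring\<close>

definition alg_end_yv ::
    "('a, 'm) ring_scheme \<Rightarrow> ((nat \<Rightarrow> nat \<Rightarrow> 'a) \<Rightarrow> (nat \<Rightarrow> nat \<Rightarrow> 'a)) set"
  where "alg_end_yv R =
    {\<gamma> \<in> ring_hom (poly_yv R) (poly_yv R).
       \<forall>b \<in> carrier R. \<gamma> (embed_y R (const_y R b)) = embed_y R (const_y R b)}"

text \<open>
  The value \<open>f(t)\<close> of \<open>f \<in> B[y]\<close> at an element \<open>t\<close> of \<open>B[y,v]\<close>.  In particular \<open>f(v)\<close> is
  \<open>poly_at R (var_v R) f\<close>, whereas \<open>f(y)\<close> is \<open>embed_y R f\<close>.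
\<close>

definition poly_at ::
    "('a, 'm) ring_scheme \<Rightarrow> (nat \<Rightarrow> nat \<Rightarrow> 'a) \<Rightarrow> (nat \<Rightarrow> 'a) \<Rightarrow> nat \<Rightarrow> nat \<Rightarrow> 'a"
  where "poly_at R = eval R (poly_yv R) (embed_y R \<circ> const_y R)"

locale bivariate = cring R for R (structure)

sublocale bivariate \<subseteq> y: UP_cring R "UP R"
  by unfold_locales simp

sublocale bivariate \<subseteq> yv: UP_cring "UP R" "UP (UP R)"
  by (rule UP_cring.intro[OF y.UP_cring]) simp

context bivariate
begin

abbreviation "Py \<equiv> UP R"
abbreviation "Pyv \<equiv> UP (UP R)"
abbreviation "Y \<equiv> embed_y R (var_y R)"
abbreviation "V \<equiv> var_v R"

lemma const_y_hom: "const_y R \<in> ring_hom R Py"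
  using y.const_ring_hom by (simp add: const_y_def[abs_def])

lemma embed_y_hom: "embed_y R \<in> ring_hom Py Pyv"
  using yv.const_ring_hom by (simp add: embed_y_def[abs_def])

lemma structure_map_hom: "embed_y R \<circ> const_y R \<in> ring_hom R Pyv"
  by (rule ring_hom_trans[OF const_y_hom embed_y_hom])

lemma var_y_closed [simp]: "var_y R \<in> carrier Py"
  by (simp add: var_y_def)

lemma V_closed [simp]: "V \<in> carrier Pyv"
  by (simp add: var_v_def)

lemma const_y_closed [simp]: "b \<in> carrier R \<Longrightarrow> const_y R b \<in> carrier Py"
  using const_y_hom by (rule ring_hom_closed)

lemma embed_y_closed [simp]: "f \<in> carrier Py \<Longrightarrow> embed_y R f \<in> carrier Pyv"
  using embed_y_hom by (rule ring_hom_closed)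

lemma poly_at_hom: "t \<in> carrier Pyv \<Longrightarrow> poly_at R t \<in> ring_hom Py Pyv"
  unfolding poly_at_def
  by (intro eval_in_ring_hom structure_map_hom y.UP_cring yv.UP_cring is_cring)

lemma poly_at_closed [simp]:
  "t \<in> carrier Pyv \<Longrightarrow> f \<in> carrier Py \<Longrightarrow> poly_at R t f \<in> carrier Pyv"
  using ring_hom_closed[OF poly_at_hom] .

lemma poly_at_const:
  "t \<in> carrier Pyv \<Longrightarrow> b \<in> carrier R \<Longrightarrow> poly_at R t (const_y R b) = embed_y R (const_y R b)"
  using eval_at_const[OF is_cring yv.UP_cring structure_map_hom]
  by (simp add: poly_at_def const_y_def)

lemma poly_at_var: "t \<in> carrier Pyv \<Longrightarrow> poly_at R t (var_y R) = t"
  using eval_at_var[OF is_cring yv.UP_cring structure_map_hom]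
  by (simp add: poly_at_def var_y_def)

lemma Py_hom_eqI:
  assumes "cring S" "\<phi> \<in> ring_hom Py S" "\<psi> \<in> ring_hom Py S"
    and "\<phi> (var_y R) = \<psi> (var_y R)"
    and "\<And>b. b \<in> carrier R \<Longrightarrow> \<phi> (const_y R b) = \<psi> (const_y R b)"
    and "f \<in> carrier Py"
  shows "\<phi> f = \<psi> f"
  using UP_hom_eqI[OF is_cring assms(1-3) _ _ assms(6)] assms(4,5)
  by (simp add: var_y_def const_y_def)

lemma poly_at_Y: "f \<in> carrier Py \<Longrightarrow> poly_at R Y f = embed_y R f"
  by (rule Py_hom_eqI[OF yv.UP_cring poly_at_hom embed_y_hom])
    (auto simp: poly_at_var poly_at_const)

lemma alg_end_poly_at:
  assumes \<phi>: "\<phi> \<in> alg_end_yv R" and t: "t \<in> carrier Pyv" and f: "f \<in> carrier Py"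
  shows "\<phi> (poly_at R t f) = poly_at R (\<phi> t) f"
proof -
  have hom: "\<phi> \<in> ring_hom Pyv Pyv"
    using \<phi> by (simp add: alg_end_yv_def)
  have t': "\<phi> t \<in> carrier Pyv"
    using ring_hom_closed[OF hom t] .
  have "(\<phi> \<circ> poly_at R t) f = poly_at R (\<phi> t) f"
    by (rule Py_hom_eqI[OF yv.UP_cring ring_hom_trans[OF poly_at_hom[OF t] hom]
          poly_at_hom[OF t']])
      (use \<phi> t t' f in \<open>simp_all add: poly_at_var poly_at_const alg_end_yv_def\<close>)
  then show ?thesis
    by simp
qed

lemma subst_y_hom: "p \<in> carrier Py \<Longrightarrow> (\<lambda>q. subst_y R q p) \<in> ring_hom Py Py"
  using eval_in_ring_hom[OF is_cring y.UP_cring const_y_hom, of p]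
  by (simp add: subst_y_def[abs_def])

lemma subst_y_closed [simp]:
  "p \<in> carrier Py \<Longrightarrow> q \<in> carrier Py \<Longrightarrow> subst_y R q p \<in> carrier Py"
  using ring_hom_closed[OF subst_y_hom] .

lemma subst_y_const:
  "p \<in> carrier Py \<Longrightarrow> b \<in> carrier R \<Longrightarrow> subst_y R (const_y R b) p = const_y R b"
  using eval_at_const[OF is_cring y.UP_cring const_y_hom] by (simp add: subst_y_def const_y_def)

lemma subst_y_var: "p \<in> carrier Py \<Longrightarrow> subst_y R (var_y R) p = p"
  using eval_at_var[OF is_cring y.UP_cring const_y_hom] by (simp add: subst_y_def var_y_def)

lemma embed_y_subst_y:
  assumes "p \<in> carrier Py" "q \<in> carrier Py"
  shows "embed_y R (subst_y R q p) = poly_at R (embed_y R p) q"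
proof -
  have "(embed_y R \<circ> (\<lambda>q. subst_y R q p)) q = poly_at R (embed_y R p) q"
    by (rule Py_hom_eqI[OF yv.UP_cring ring_hom_trans[OF subst_y_hom embed_y_hom] poly_at_hom])
      (use assms in \<open>simp_all add: poly_at_var poly_at_const subst_y_var subst_y_const\<close>)
  then show ?thesis
    by simp
qed

text \<open>
  The difference \<open>s - t\<close> divides \<open>f(s) - f(t)\<close>.  Evaluation at \<open>s\<close> and at \<open>t\<close>, followed by
  reduction modulo \<open>J\<close>, are homomorphisms on \<open>B[y]\<close> that agree on constants and on \<open>y\<close>.
\<close>

lemma poly_at_cong_ideal:
  assumes J: "ideal J Pyv" and s: "s \<in> carrier Pyv" and t: "t \<in> carrier Pyv"
    and diff: "s \<ominus>\<^bsub>Pyv\<^esub> t \<in> J" and f: "f \<in> carrier Py"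
  shows "poly_at R s f \<ominus>\<^bsub>Pyv\<^esub> poly_at R t f \<in> J"
proof -
  interpret J: ideal J Pyv by (rule J)
  let ?\<pi> = "(+>\<^bsub>Pyv\<^esub>) J"
  have "?\<pi> s = ?\<pi> t"
    using yv.P.quotient_eq_iff_same_a_r_cos[OF J s t] diff by blast
  have "(?\<pi> \<circ> poly_at R s) f = (?\<pi> \<circ> poly_at R t) f"
    by (rule Py_hom_eqI[OF J.quotient_is_cring[OF yv.UP_cring]
          ring_hom_trans[OF poly_at_hom J.rcos_ring_hom]
          ring_hom_trans[OF poly_at_hom J.rcos_ring_hom]])
      (use \<open>?\<pi> s = ?\<pi> t\<close> s t f in \<open>simp_all add: poly_at_var poly_at_const\<close>)
  then show ?thesis
    using yv.P.quotient_eq_iff_same_a_r_cos[OF J] s t f by simp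
qed

lemma alg_end_exists:
  assumes s: "s \<in> carrier Pyv" and t: "t \<in> carrier Pyv"
  obtains \<phi> where "\<phi> \<in> alg_end_yv R" "\<phi> Y = s" "\<phi> V = t"
proof
  let ?\<phi> = "eval Py Pyv (poly_at R s) t"
  note ev = y.UP_cring yv.UP_cring poly_at_hom[OF s] t
  have embed: "?\<phi> (embed_y R f) = poly_at R s f" if "f \<in> carrier Py" for f
    using eval_at_const[OF ev that] by (simp add: embed_y_def)
  show "?\<phi> \<in> alg_end_yv R"
    using eval_in_ring_hom[OF ev] s by (auto simp: alg_end_yv_def embed poly_at_const)
  show "?\<phi> Y = s"
    using s by (simp add: embed poly_at_var)
  show "?\<phi> V = t"
    using eval_at_var[OF ev] by (simp add: var_v_def)
qed

lemma alg_end_id: "id \<in> alg_end_yv R"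
  by (simp add: alg_end_yv_def ring_hom_memI)

lemma alg_end_comp:
  "\<phi> \<in> alg_end_yv R \<Longrightarrow> \<psi> \<in> alg_end_yv R \<Longrightarrow> \<psi> \<circ> \<phi> \<in> alg_end_yv R"
  by (auto simp: alg_end_yv_def simp del: o_apply intro: ring_hom_trans) simp

lemma alg_end_closed: "\<phi> \<in> alg_end_yv R \<Longrightarrow> x \<in> carrier Pyv \<Longrightarrow> \<phi> x \<in> carrier Pyv"
  using ring_hom_closed[of \<phi> Pyv Pyv x] by (simp add: alg_end_yv_def)

text \<open>
  Two steps of uniqueness: agreement at \<open>y\<close> gives agreement on \<open>B[y]\<close>, which is the
  coefficient ring of \<open>B[y][v]\<close>, and then agreement at \<open>v\<close> suffices.
\<close>

lemma alg_end_eqI: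
  assumes \<phi>: "\<phi> \<in> alg_end_yv R" and \<psi>: "\<psi> \<in> alg_end_yv R"
    and Y: "\<phi> Y = \<psi> Y" and V: "\<phi> V = \<psi> V" and x: "x \<in> carrier Pyv"
  shows "\<phi> x = \<psi> x"
proof (rule UP_hom_eqI[OF y.UP_cring yv.UP_cring _ _ _ _ x])
  show "\<phi> \<in> ring_hom Pyv Pyv" "\<psi> \<in> ring_hom Pyv Pyv"
    using \<phi> \<psi> by (auto simp: alg_end_yv_def)
  show "\<phi> (monom Pyv \<one>\<^bsub>Py\<^esub> 1) = \<psi> (monom Pyv \<one>\<^bsub>Py\<^esub> 1)"
    using V by (simp add: var_v_def)
  show "\<phi> (monom Pyv f 0) = \<psi> (monom Pyv f 0)" if f: "f \<in> carrier Py" for f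
  proof -
    have "\<phi> (embed_y R f) = \<psi> (embed_y R f)"
      using alg_end_poly_at[OF \<phi> _ f, of Y] alg_end_poly_at[OF \<psi> _ f, of Y] Y f
      by (simp add: poly_at_Y)
    then show ?thesis
      by (simp add: embed_y_def)
  qed
qed

lemma alg_end_invertible:
  assumes \<phi>: "\<phi> \<in> alg_end_yv R" and \<psi>: "\<psi> \<in> alg_end_yv R"
    and "\<psi> (\<phi> Y) = Y" "\<psi> (\<phi> V) = V" "\<phi> (\<psi> Y) = Y" "\<phi> (\<psi> V) = V"
  shows "\<phi> \<in> alg_aut_yv R"
proof -
  have "\<psi> (\<phi> x) = x" "\<phi> (\<psi> x) = x" if "x \<in> carrier Pyv" for x
    using alg_end_eqI[OF alg_end_comp[OF \<phi> \<psi>] alg_end_id _ _ that]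
      alg_end_eqI[OF alg_end_comp[OF \<psi> \<phi>] alg_end_id _ _ that] assms(3-6) by auto
  then have "bij_betw \<phi> (carrier Pyv) (carrier Pyv)"
    using alg_end_closed \<phi> \<psi> by (intro bij_betw_byWitness[where f' = \<psi>]) auto
  then show ?thesis
    using \<phi> by (simp add: alg_aut_yv_def alg_end_yv_def ring_iso_def)
qed

lemma alg_aut_shear:
  assumes f: "f \<in> carrier Py"
  obtains \<phi> where "\<phi> \<in> alg_aut_yv R" "\<phi> Y = Y" "\<phi> V = V \<ominus>\<^bsub>Pyv\<^esub> embed_y R f"
proof -
  obtain \<phi> where \<phi>: "\<phi> \<in> alg_end_yv R" "\<phi> Y = Y" "\<phi> V = V \<ominus>\<^bsub>Pyv\<^esub> embed_y R f"
    using alg_end_exists[of Y "V \<ominus>\<^bsub>Pyv\<^esub> embed_y R f"] f by auto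
  obtain \<psi> where \<psi>: "\<psi> \<in> alg_end_yv R" "\<psi> Y = Y" "\<psi> V = V \<oplus>\<^bsub>Pyv\<^esub> embed_y R f"
    using alg_end_exists[of Y "V \<oplus>\<^bsub>Pyv\<^esub> embed_y R f"] f by auto
  have hom: "\<phi> \<in> ring_hom Pyv Pyv" "\<psi> \<in> ring_hom Pyv Pyv"
    using \<phi>(1) \<psi>(1) by (auto simp: alg_end_yv_def)
  \<comment> \<open>Both endomorphisms fix \<open>y\<close>, hence all of \<open>B[y]\<close>.\<close>
  have fixed: "\<phi> (embed_y R f) = embed_y R f" "\<psi> (embed_y R f) = embed_y R f"
    using alg_end_poly_at[of _ Y f] \<phi> \<psi> f by (auto simp: poly_at_Y)
  have F: "embed_y R f \<in> carrier Pyv"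
    using f by simp
  have "\<phi> (\<psi> V) = (V \<ominus>\<^bsub>Pyv\<^esub> embed_y R f) \<oplus>\<^bsub>Pyv\<^esub> embed_y R f"
    using ring_hom_add[OF hom(1) V_closed F] \<phi>(3) \<psi>(3) fixed by simp
  also have "\<dots> = V"
    using F V_closed by (simp add: a_minus_def yv.P.a_assoc yv.P.l_neg)
  finally have 1: "\<phi> (\<psi> V) = V" .
  have "\<psi> (\<phi> V) = (V \<oplus>\<^bsub>Pyv\<^esub> embed_y R f) \<ominus>\<^bsub>Pyv\<^esub> embed_y R f"
    using ring_hom_minus[OF yv.UP_ring yv.UP_ring hom(2) V_closed F] \<phi>(3) \<psi>(3) fixed by simp
  also have "\<dots> = V"
    using F V_closed by (simp add: a_minus_def yv.P.a_assoc yv.P.r_neg)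
  finally have 2: "\<psi> (\<phi> V) = V" .
  show ?thesis
    using that \<phi> \<psi> 1 2 by (metis alg_end_invertible)
qed

lemma alg_aut_swap:
  obtains \<sigma> where "\<sigma> \<in> alg_aut_yv R" "\<sigma> Y = V" "\<sigma> V = Y"
proof -
  obtain \<sigma> where "\<sigma> \<in> alg_end_yv R" "\<sigma> Y = V" "\<sigma> V = Y"
    using alg_end_exists[of V Y] by auto
  then show ?thesis
    using that by (metis alg_end_invertible)
qed

lemma alg_aut_subset_end: "\<phi> \<in> alg_aut_yv R \<Longrightarrow> \<phi> \<in> alg_end_yv R"
  by (auto simp: alg_aut_yv_def alg_end_yv_def ring_iso_def)

lemma alg_aut_comp:
  assumes "\<phi> \<in> alg_aut_yv R" "\<psi> \<in> alg_aut_yv R"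
  shows "\<psi> \<circ> \<phi> \<in> alg_aut_yv R"
  using assms ring_iso_set_trans[of \<phi> Pyv Pyv \<psi> Pyv] by (auto simp: alg_aut_yv_def)

lemma alg_aut_inv:
  assumes \<phi>: "\<phi> \<in> alg_aut_yv R"
  shows "inv_into (carrier Pyv) \<phi> \<in> alg_aut_yv R"
proof -
  have iso: "\<phi> \<in> ring_iso Pyv Pyv"
    using \<phi> by (simp add: alg_aut_yv_def)
  then have inj: "inj_on \<phi> (carrier Pyv)"
    by (simp add: ring_iso_def bij_betw_def)
  have "inv_into (carrier Pyv) \<phi> (embed_y R (const_y R b)) = embed_y R (const_y R b)"
    if "b \<in> carrier R" for b
    using \<phi> that by (intro inv_into_f_eq[OF inj]) (auto simp: alg_aut_yv_def)
  then show ?thesis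
    using ring_iso_set_sym[OF yv.UP_ring iso] by (simp add: alg_aut_yv_def)
qed

section \<open>Equivalence of ideals under automorphisms\<close>

definition aut_equiv :: "(nat \<Rightarrow> nat \<Rightarrow> 'a) set \<Rightarrow> (nat \<Rightarrow> nat \<Rightarrow> 'a) set \<Rightarrow> bool"
  where "aut_equiv I J \<longleftrightarrow> (\<exists>\<gamma> \<in> alg_aut_yv R. \<gamma> ` I = J)"

lemma aut_equiv_trans: "aut_equiv I J \<Longrightarrow> aut_equiv J K \<Longrightarrow> aut_equiv I K"
  unfolding aut_equiv_def by (metis alg_aut_comp image_comp)

lemma aut_equiv_sym:
  assumes "aut_equiv I J" and I: "I \<subseteq> carrier Pyv"
  shows "aut_equiv J I"
proof -
  obtain \<phi> where \<phi>: "\<phi> \<in> alg_aut_yv R" "J = \<phi> ` I"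
    using assms(1) by (auto simp: aut_equiv_def)
  then have "inj_on \<phi> (carrier Pyv)"
    by (simp add: alg_aut_yv_def ring_iso_def bij_betw_def)
  then have "inv_into (carrier Pyv) \<phi> ` J = I"
    using \<phi>(2) I by (simp add: inv_into_image_cancel)
  then show ?thesis
    using alg_aut_inv[OF \<phi>(1)] by (auto simp: aut_equiv_def)
qed

lemma alg_aut_image_genideal:
  assumes "\<phi> \<in> alg_aut_yv R" "f \<in> carrier Pyv" "g \<in> carrier Pyv"
  shows "\<phi> ` (Idl\<^bsub>Pyv\<^esub> {f, g}) = Idl\<^bsub>Pyv\<^esub> {\<phi> f, \<phi> g}"
  using ring_iso_image_genideal[OF yv.UP_ring yv.UP_ring, of \<phi> "{f, g}"] assms
  by (simp add: alg_aut_yv_def)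

text \<open>
  The target is the ideal of the scheme-theoretic intersection of the curves \<open>y = q(v)\<close> and
  \<open>v = p(y)\<close> in the plane, in which \<open>p\<close> and \<open>q\<close> play symmetric roles.
\<close>

lemma ideal_v_equiv_graph_ideal:
  assumes p: "p \<in> carrier Py" and q: "q \<in> carrier Py"
  shows "aut_equiv (ideal_v R (var_y R \<ominus>\<^bsub>Py\<^esub> subst_y R q p))
    (Idl\<^bsub>Pyv\<^esub> {Y \<ominus>\<^bsub>Pyv\<^esub> poly_at R V q, V \<ominus>\<^bsub>Pyv\<^esub> poly_at R Y p})"
proof -
  obtain \<phi> where \<phi>: "\<phi> \<in> alg_aut_yv R" "\<phi> Y = Y" "\<phi> V = V \<ominus>\<^bsub>Pyv\<^esub> embed_y R p"
    using alg_aut_shear[OF p] .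
  let ?f = "var_y R \<ominus>\<^bsub>Py\<^esub> subst_y R q p"
  let ?P = "poly_at R Y p"
  have f: "?f \<in> carrier Py"
    using p q by simp
  have carr: "Y \<in> carrier Pyv" "?P \<in> carrier Pyv" "poly_at R ?P q \<in> carrier Pyv"
      "poly_at R V q \<in> carrier Pyv"
    using p q by auto
  have embed: "embed_y R ?f = Y \<ominus>\<^bsub>Pyv\<^esub> poly_at R ?P q"
    using p q ring_hom_minus[OF y.UP_ring yv.UP_ring embed_y_hom var_y_closed, of "subst_y R q p"]
    by (simp add: embed_y_subst_y poly_at_Y)
  have "\<phi> (embed_y R ?f) = embed_y R ?f"
    using alg_end_poly_at[OF alg_aut_subset_end[OF \<phi>(1)] _ f, of Y] f
    by (simp add: poly_at_Y \<phi>(2))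
  then have "\<phi> ` ideal_v R ?f = Idl\<^bsub>Pyv\<^esub> {Y \<ominus>\<^bsub>Pyv\<^esub> poly_at R ?P q, V \<ominus>\<^bsub>Pyv\<^esub> ?P}"
    using alg_aut_image_genideal[OF \<phi>(1) embed_y_closed[OF f] V_closed] p \<phi>(3)
    by (simp add: ideal_v_def embed poly_at_Y)
  also have "\<dots> = Idl\<^bsub>Pyv\<^esub> {Y \<ominus>\<^bsub>Pyv\<^esub> poly_at R V q, V \<ominus>\<^bsub>Pyv\<^esub> ?P}"
  proof (rule yv.P.genideal_replace_congruent)
    fix I assume I: "ideal I Pyv" "V \<ominus>\<^bsub>Pyv\<^esub> ?P \<in> I"
    have "poly_at R V q \<ominus>\<^bsub>Pyv\<^esub> poly_at R ?P q \<in> I"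
      using poly_at_cong_ideal[OF I(1) V_closed carr(2) I(2) q] .
    moreover have "(Y \<ominus>\<^bsub>Pyv\<^esub> poly_at R ?P q) \<ominus>\<^bsub>Pyv\<^esub> (Y \<ominus>\<^bsub>Pyv\<^esub> poly_at R V q)
        = poly_at R V q \<ominus>\<^bsub>Pyv\<^esub> poly_at R ?P q"
      using carr by algebra
    ultimately show "(Y \<ominus>\<^bsub>Pyv\<^esub> poly_at R ?P q) \<ominus>\<^bsub>Pyv\<^esub> (Y \<ominus>\<^bsub>Pyv\<^esub> poly_at R V q) \<in> I"
      by simp
  qed (use carr in auto)
  finally show ?thesis
    using \<phi>(1) by (auto simp: aut_equiv_def)
qed

text \<open>
  The swap of \<open>y\<close> and \<open>v\<close> links the symmetric ideals of \<open>(p, q)\<close> and \<open>(q, p)\<close>, and each of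
  these is linked to one of the two given ideals by a shear.
\<close>

theorem ideal_v_subst_equiv:
  assumes p: "p \<in> carrier Py" and q: "q \<in> carrier Py"
  shows "aut_equiv (ideal_v R (var_y R \<ominus>\<^bsub>Py\<^esub> subst_y R q p))
    (ideal_v R (var_y R \<ominus>\<^bsub>Py\<^esub> subst_y R p q))"
proof -
  let ?G = "\<lambda>p q. Idl\<^bsub>Pyv\<^esub> {Y \<ominus>\<^bsub>Pyv\<^esub> poly_at R V q, V \<ominus>\<^bsub>Pyv\<^esub> poly_at R Y p}"
  obtain \<sigma> where \<sigma>: "\<sigma> \<in> alg_aut_yv R" "\<sigma> Y = V" "\<sigma> V = Y"
    using alg_aut_swap .
  have endo: "\<sigma> \<in> alg_end_yv R" "\<sigma> \<in> ring_hom Pyv Pyv"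
    using alg_aut_subset_end[OF \<sigma>(1)] by (auto simp: alg_end_yv_def)
  have "\<sigma> (Y \<ominus>\<^bsub>Pyv\<^esub> poly_at R V q) = V \<ominus>\<^bsub>Pyv\<^esub> poly_at R Y q"
    "\<sigma> (V \<ominus>\<^bsub>Pyv\<^esub> poly_at R Y p) = Y \<ominus>\<^bsub>Pyv\<^esub> poly_at R V p"
    using p q \<sigma> alg_end_poly_at[OF endo(1)]
    by (simp_all add: ring_hom_minus[OF yv.UP_ring yv.UP_ring endo(2)])
  then have "\<sigma> ` ?G p q = ?G q p"
    using alg_aut_image_genideal[OF \<sigma>(1), of "Y \<ominus>\<^bsub>Pyv\<^esub> poly_at R V q" "V \<ominus>\<^bsub>Pyv\<^esub> poly_at R Y p"]
      p q
    by (simp add: insert_commute)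
  then have "aut_equiv (?G p q) (?G q p)"
    using \<sigma>(1) by (auto simp: aut_equiv_def)
  moreover have "ideal_v R (var_y R \<ominus>\<^bsub>Py\<^esub> subst_y R p q) \<subseteq> carrier Pyv"
    using p q unfolding ideal_v_def
    by (intro yv.P.genideal_minimal yv.P.oneideal) auto
  ultimately show ?thesis
    using ideal_v_equiv_graph_ideal[OF p q] ideal_v_equiv_graph_ideal[OF q p]
    by (meson aut_equiv_sym aut_equiv_trans)
qed

section \<open>Rescaling the variable\<close>

lemma coeff_sum_monom:
  assumes "finite A" "\<And>i. i \<in> A \<Longrightarrow> f i \<in> carrier R"
  shows "coeff Py (\<Oplus>\<^bsub>Py\<^esub>i \<in> A. monom Py (f i) i) n = (if n \<in> A then f n else \<zero>)"
proof -
  have "coeff Py (\<Oplus>\<^bsub>Py\<^esub>i \<in> A. monom Py (f i) i) n = (\<Oplus>i \<in> A. if n = i then f i else \<zero>)"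
    using assms by (subst y.coeff_finsum) (auto intro!: finsum_cong' split: if_splits)
  also have "\<dots> = (if n \<in> A then f n else \<zero>)"
  proof (cases "n \<in> A")
    case True
    then show ?thesis
      using assms add.finprod_singleton[of n A f] by auto
  next
    case False
    then have "(\<Oplus>i \<in> A. if n = i then f i else \<zero>) = (\<Oplus>i \<in> A. \<zero>)"
      by (intro finsum_cong') auto
    then show ?thesis
      using False by simp
  qed
  finally show ?thesis .
qed

lemma smult_var_y: "a \<in> carrier R \<Longrightarrow> a \<odot>\<^bsub>Py\<^esub> var_y R = monom Py a 1"
  using y.monom_mult_smult[of a \<one> 1] by (simp add: var_y_def)

lemma coeff_subst_y_scale:
  assumes a: "a \<in> carrier R" and p: "p \<in> carrier Py"
  shows "coeff Py (subst_y R p (a \<odot>\<^bsub>Py\<^esub> var_y R)) n = coeff Py p n \<otimes> a [^] n"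
proof -
  have "subst_y R p (a \<odot>\<^bsub>Py\<^esub> var_y R)
      = (\<Oplus>\<^bsub>Py\<^esub>i \<in> {..deg R p}. const_y R (coeff Py p i) \<otimes>\<^bsub>Py\<^esub> monom Py a 1 [^]\<^bsub>Py\<^esub> i)"
    using p a unfolding subst_y_def by (simp add: y.eval_on_carrier smult_var_y)
  also have "\<dots> = (\<Oplus>\<^bsub>Py\<^esub>i \<in> {..deg R p}. monom Py (coeff Py p i \<otimes> a [^] i) i)"
    using a p
    by (intro y.P.finsum_cong')
      (auto simp: const_y_def y.monom_pow y.monom_mult[symmetric] simp del: y.monom_mult)
  finally show ?thesis
    using a p by (auto simp: coeff_sum_monom y.deg_aboveD)
qed

lemma scaled_quot_closed [simp]:
  "a \<in> carrier R \<Longrightarrow> c \<in> carrier R \<Longrightarrow> p \<in> carrier Py \<Longrightarrow> scaled_quot R a k c p \<in> carrier Py"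
  unfolding scaled_quot_def by (intro y.UP_a_closed y.P.finsum_closed) auto

lemma coeff_scaled_quot:
  assumes "a \<in> carrier R" "c \<in> carrier R" "p \<in> carrier Py"
  shows "coeff Py (scaled_quot R a k c p) n
    = (if n = 0 then c else coeff Py p n \<otimes> a [^] ((k + 1) * n - k))"
proof -
  have "(\<Oplus>\<^bsub>Py\<^esub>i \<in> {1..deg R p}. monom Py (coeff Py p i \<otimes> a [^] ((k + 1) * i - k)) i) \<in> carrier Py"
    using assms by (intro y.P.finsum_closed) auto
  then show ?thesis
    using assms unfolding scaled_quot_def
    by (subst y.coeff_add) (auto simp del: mult_Suc simp: coeff_sum_monom const_y_def y.deg_aboveD)
qed

lemma eval_zero_eq_coeff:
  assumes p: "p \<in> carrier Py"
  shows "eval R R id \<zero> p = coeff Py p 0"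
proof -
  have "eval R R id \<zero> p = (\<Oplus>i \<in> {..deg R p}. coeff Py p i \<otimes> \<zero> [^] i)"
    using p by (simp add: y.eval_on_carrier)
  also have "\<dots> = (\<Oplus>i \<in> {..deg R p}. if 0 = i then coeff Py p i else \<zero>)"
    using p by (intro finsum_cong') (auto simp: nat_pow_zero)
  also have "\<dots> = coeff Py p 0"
    using p by (intro add.finprod_singleton) auto
  finally show ?thesis .
qed

text \<open>
  The substitution symmetry for the polynomials \<open>-p\<close> and \<open>a y\<close>: one composite is \<open>-a p(y)\<close>, the
  other one is \<open>-p(a y)\<close>.
\<close>

lemma ideal_v_scale_equiv:
  assumes a: "a \<in> carrier R" and p: "p \<in> carrier Py"
  shows "aut_equiv (ideal_v R (var_y R \<oplus>\<^bsub>Py\<^esub> a \<odot>\<^bsub>Py\<^esub> p))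
    (ideal_v R (var_y R \<oplus>\<^bsub>Py\<^esub> subst_y R p (a \<odot>\<^bsub>Py\<^esub> var_y R)))"
proof -
  let ?q = "a \<odot>\<^bsub>Py\<^esub> var_y R" and ?p = "\<ominus>\<^bsub>Py\<^esub> p"
  have q: "?q \<in> carrier Py" and p': "?p \<in> carrier Py"
    using a p by auto
  have neg: "var_y R \<ominus>\<^bsub>Py\<^esub> (\<ominus>\<^bsub>Py\<^esub> f) = var_y R \<oplus>\<^bsub>Py\<^esub> f" if "f \<in> carrier Py" for f
    using that by (simp add: a_minus_def)
  have smult: "b \<odot>\<^bsub>Py\<^esub> f = const_y R b \<otimes>\<^bsub>Py\<^esub> f" if "b \<in> carrier R" "f \<in> carrier Py" for b f
    using that by (simp add: const_y_def y.monom_mult_is_smult)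
  have "subst_y R ?q ?p = const_y R a \<otimes>\<^bsub>Py\<^esub> ?p"
    using a p' ring_hom_mult[OF subst_y_hom[OF p'], of "const_y R a" "var_y R"]
    by (simp add: smult subst_y_const subst_y_var)
  also have "\<dots> = \<ominus>\<^bsub>Py\<^esub> (a \<odot>\<^bsub>Py\<^esub> p)"
    using a p by (simp add: smult y.P.r_minus)
  finally have 1: "subst_y R ?q ?p = \<ominus>\<^bsub>Py\<^esub> (a \<odot>\<^bsub>Py\<^esub> p)" .
  interpret S: ring_hom_ring Py Py "\<lambda>f. subst_y R f ?q"
    using subst_y_hom[OF q] y.UP_ring by (simp add: ring_hom_ringI2)
  have 2: "subst_y R ?p ?q = \<ominus>\<^bsub>Py\<^esub> subst_y R p ?q"
    using p by simp
  show ?thesis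
    using ideal_v_subst_equiv[OF p' q] a p q unfolding 1 2 by (simp add: neg)
qed

text \<open>
  Induction on \<open>k\<close>, with one rescaling step each time.  The exponents add up because
  \<open>(i - 1) + ((k + 1) i - k) = (k + 2) i - (k + 1)\<close>.
\<close>

theorem ideal_v_scaled_quot_equiv:
  assumes a: "a \<in> carrier R"
  shows "p \<in> carrier Py \<Longrightarrow> c \<in> carrier R \<Longrightarrow> coeff Py p 0 = a [^] k \<otimes> c \<Longrightarrow>
    aut_equiv (ideal_v R (var_y R \<oplus>\<^bsub>Py\<^esub> a \<odot>\<^bsub>Py\<^esub> p))
      (ideal_v R (var_y R \<oplus>\<^bsub>Py\<^esub> scaled_quot R a k c p))"
proof (induction k arbitrary: p)
  case 0
  have "scaled_quot R a 0 c p = subst_y R p (a \<odot>\<^bsub>Py\<^esub> var_y R)"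
    using a 0 by (intro y.up_eqI) (auto simp: coeff_scaled_quot coeff_subst_y_scale)
  then show ?case
    using ideal_v_scale_equiv[OF a] 0 by simp
next
  case (Suc k)
  \<comment> \<open>This is \<open>p(a y)/a\<close>.  Since \<open>a\<close> may be a zero divisor, the quotient is a choice; the one
    made here has constant term \<open>a^k c\<close>, which is what the induction hypothesis needs.\<close>
  define p' where "p' = (\<lambda>i. if i = 0 then a [^] k \<otimes> c else coeff Py p i \<otimes> a [^] (i - 1))"
  have p': "p' \<in> carrier Py"
  proof -
    have "bound \<zero> (deg R p) p'"
      using a Suc.prems by (intro bound.intro) (auto simp: p'_def y.deg_aboveD)
    moreover have "p' i \<in> carrier R" for i
      using a Suc.prems by (simp add: p'_def)
    ultimately have "p' \<in> up R"
      by blast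
    then show ?thesis
      by (simp add: UP_def)
  qed
  then have coeff_p': "coeff Py p' i =
      (if i = 0 then a [^] k \<otimes> c else coeff Py p i \<otimes> a [^] (i - 1))" for i
    by (simp add: UP_def p'_def)
  have "subst_y R p (a \<odot>\<^bsub>Py\<^esub> var_y R) = a \<odot>\<^bsub>Py\<^esub> p'"
  proof (rule y.up_eqI)
    fix n
    show "coeff Py (subst_y R p (a \<odot>\<^bsub>Py\<^esub> var_y R)) n = coeff Py (a \<odot>\<^bsub>Py\<^esub> p') n"
    proof (cases n)
      case 0
      then show ?thesis
        using a Suc.prems p' by (simp add: coeff_subst_y_scale coeff_p' m_ac)
    next
      case (Suc m)
      then show ?thesis
        using a \<open>p \<in> carrier Py\<close> p' by (simp add: coeff_subst_y_scale coeff_p' m_ac)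
    qed
  qed (use a Suc.prems p' in auto)
  then have "aut_equiv (ideal_v R (var_y R \<oplus>\<^bsub>Py\<^esub> a \<odot>\<^bsub>Py\<^esub> p))
      (ideal_v R (var_y R \<oplus>\<^bsub>Py\<^esub> a \<odot>\<^bsub>Py\<^esub> p'))"
    using ideal_v_scale_equiv[OF a, of p] Suc.prems by simp
  moreover have "scaled_quot R a k c p' = scaled_quot R a (Suc k) c p"
  proof (rule y.up_eqI)
    fix n
    show "coeff Py (scaled_quot R a k c p') n = coeff Py (scaled_quot R a (Suc k) c p) n"
    proof (cases n)
      case (Suc m)
      have "m + ((k + 1) * Suc m - k) = (Suc k + 1) * Suc m - Suc k"
        by simp
      then have "a [^] m \<otimes> a [^] ((k + 1) * Suc m - k) = a [^] ((Suc k + 1) * Suc m - Suc k)"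
        using a by (simp only: nat_pow_mult)
      then show ?thesis
        using a \<open>p \<in> carrier Py\<close> \<open>c \<in> carrier R\<close> p' Suc
        by (simp add: coeff_scaled_quot coeff_p' m_assoc del: mult_Suc mult_Suc_right)
    qed (use a Suc.prems p' in \<open>simp add: coeff_scaled_quot\<close>)
  qed (use a Suc.prems p' in auto)
  ultimately show ?case
    using Suc.IH[OF p'] Suc.prems by (auto simp: coeff_p' intro: aut_equiv_trans)
qed

end

section \<open>Interchanging two substitutions\<close>

theorem proposition1p31:
  fixes R :: "('a, 'm) ring_scheme"
  assumes "cring R"
  shows
    "(\<forall>p \<in> carrier (UP R). \<forall>q \<in> carrier (UP R).
        \<exists>\<gamma> \<in> alg_aut_yv R.
          \<gamma> ` ideal_v R (var_y R \<ominus>\<^bsub>UP R\<^esub> subst_y R q p)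
            = ideal_v R (var_y R \<ominus>\<^bsub>UP R\<^esub> subst_y R p q))
     \<and>
     (\<forall>a \<in> carrier R. \<forall>p \<in> carrier (UP R).
        (\<exists>\<gamma> \<in> alg_aut_yv R.
           \<gamma> ` ideal_v R (var_y R \<oplus>\<^bsub>UP R\<^esub> a \<odot>\<^bsub>UP R\<^esub> p)
             = ideal_v R (var_y R \<oplus>\<^bsub>UP R\<^esub> subst_y R p (a \<odot>\<^bsub>UP R\<^esub> var_y R)))
        \<and>
        (\<forall>k :: nat. \<forall>c \<in> carrier R.
           eval R R id \<zero>\<^bsub>R\<^esub> p = a [^]\<^bsub>R\<^esub> k \<otimes>\<^bsub>R\<^esub> c \<longrightarrow>
           (\<exists>\<gamma> \<in> alg_aut_yv R.
              \<gamma> ` ideal_v R (var_y R \<oplus>\<^bsub>UP R\<^esub> a \<odot>\<^bsub>UP R\<^esub> p)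
                = ideal_v R (var_y R \<oplus>\<^bsub>UP R\<^esub> scaled_quot R a k c p))))"
proof -
  interpret bivariate R
    using assms by (rule bivariate.intro)
  show ?thesis
    using ideal_v_subst_equiv ideal_v_scale_equiv ideal_v_scaled_quot_equiv
    by (simp add: eval_zero_eq_coeff aut_equiv_def)
qed

end
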